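(* Let $\Omega_1\subset\mathbb C^n$ and $\Omega_2\subset\mathbb C^m$ be bounded domains. If $\varphi:E(\Omega_1)\to E(\Omega_2)$ is an epimorphism of semigroups, then $\varphi$ is an isomorphism.
   Context: A domain is a non-empty connected open set. For a domain $\Omega\subset\mathbb C^n$ ($n\ge1$), $E(\Omega)$ denotes the semigroup, under composition, of all analytic (holomorphic) maps $\Omega\to\Omega$, with the identity map as unit. An epimorphism is a surjective semigroup homomorphism; an isomorphism is a bijective one. *)

theory Defs
  imports "HOL-Analysis.Analysis" "HOL-Algebra.Group"
begin

definition is_domain :: "(complex ^ 'n) set \<Rightarrow> bool" where
  "is_domain S \<longleftrightarrow> S \<noteq> {} \<and> open S \<and> connected S"

text \<open>\<^const>\<open>has_derivative\<close> only sees the real normed space underlying \<open>\<complex>\<^sup>n\<close>, so complex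
  differentiability asks in addition that the real-linear derivative be homogeneous over the
  complex numbers; \<open>*s\<close> is complex scalar multiplication of vectors.\<close>

definition holomorphic_map_on ::
    "(complex ^ 'n \<Rightarrow> complex ^ 'm) \<Rightarrow> (complex ^ 'n) set \<Rightarrow> bool" where
  "holomorphic_map_on f S \<longleftrightarrow>
     (\<forall>z\<in>S. \<exists>D. (f has_derivative D) (at z within S) \<and> (\<forall>c v. D (c *s v) = c *s D v))"

text \<open>A map \<open>S \<rightarrow> S\<close> is represented by the function that agrees with it on \<open>S\<close> and is
  \<^const>\<open>undefined\<close> elsewhere, so that equality in the carrier is equality of maps on \<open>S\<close>.\<close>

definition holo_endos :: "(complex ^ 'n) set \<Rightarrow> (complex ^ 'n \<Rightarrow> complex ^ 'n) monoid" where
  "holo_endos S =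
     \<lparr>carrier = {f \<in> S \<rightarrow>\<^sub>E S. holomorphic_map_on f S},
      mult = compose S,
      one = (\<lambda>z\<in>S. z)\<rparr>"

lemma holomorphic_map_on_cong:
  assumes "\<And>z. z \<in> S \<Longrightarrow> f z = g z" "holomorphic_map_on f S"
  shows "holomorphic_map_on g S"
  unfolding holomorphic_map_on_def
proof
  fix z assume z: "z \<in> S"
  then obtain D where D: "(f has_derivative D) (at z within S)" "\<forall>c v. D (c *s v) = c *s D v"
    using assms(2) unfolding holomorphic_map_on_def by blast
  have "(g has_derivative D) (at z within S)"
    by (rule has_derivative_transform[OF z _ D(1)]) (simp add: assms(1))
  with D(2) show "\<exists>D. (g has_derivative D) (at z within S) \<and> (\<forall>c v. D (c *s v) = c *s D v)"
    by blast
qed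

lemma holomorphic_map_on_comp:
  assumes f: "holomorphic_map_on f S" "f ` S \<subseteq> T" and g: "holomorphic_map_on g T"
  shows "holomorphic_map_on (g \<circ> f) S"
  unfolding holomorphic_map_on_def
proof
  fix z assume z: "z \<in> S"
  then obtain D where D: "(f has_derivative D) (at z within S)" "\<forall>c v. D (c *s v) = c *s D v"
    using f(1) unfolding holomorphic_map_on_def by blast
  have "f z \<in> T" using z f(2) by blast
  then obtain D' where D': "(g has_derivative D') (at (f z) within T)"
      "\<forall>c v. D' (c *s v) = c *s D' v"
    using g unfolding holomorphic_map_on_def by blast
  have "(g has_derivative D') (at (f z) within f ` S)"
    using D'(1) f(2) by (rule has_derivative_subset)
  then have "(g \<circ> f has_derivative D' \<circ> D) (at z within S)"
    using D(1) by (rule diff_chain_within[rotated])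
  moreover have "\<forall>c v. (D' \<circ> D) (c *s v) = c *s (D' \<circ> D) v"
    using D(2) D'(2) by simp
  ultimately show "\<exists>D. (g \<circ> f has_derivative D) (at z within S) \<and> (\<forall>c v. D (c *s v) = c *s D v)"
    by blast
qed

lemma holomorphic_map_on_id: "holomorphic_map_on (\<lambda>z. z) S"
  unfolding holomorphic_map_on_def using has_derivative_ident by blast

lemma monoid_holo_endos: "monoid (holo_endos S)"
proof (rule monoidI, goal_cases)
  case (1 f g)
  then have f: "f \<in> S \<rightarrow>\<^sub>E S" "holomorphic_map_on f S" and g: "g \<in> S \<rightarrow>\<^sub>E S" "holomorphic_map_on g S"
    by (auto simp: holo_endos_def)
  have "g ` S \<subseteq> S" using g(1) by auto
  then have "holomorphic_map_on (f \<circ> g) S"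
    by (rule holomorphic_map_on_comp[OF g(2) _ f(2)])
  then have "holomorphic_map_on (compose S f g) S"
    by (rule holomorphic_map_on_cong[rotated]) (simp add: compose_def)
  moreover have "compose S f g \<in> S \<rightarrow>\<^sub>E S"
    using f(1) g(1) by (auto simp: compose_def)
  ultimately show ?case by (simp add: holo_endos_def)
next
  case 2
  show ?case
    using holomorphic_map_on_cong[OF _ holomorphic_map_on_id, of S "\<lambda>z\<in>S. z"]
    by (auto simp: holo_endos_def)
next
  case (3 f g h)
  then show ?case by (auto simp: holo_endos_def compose_def fun_eq_iff PiE_def Pi_def)
next
  case (4 f)
  then show ?case by (auto simp: holo_endos_def compose_def fun_eq_iff PiE_def Pi_def extensional_def)
next
  case (5 f)
  then show ?case by (auto simp: holo_endos_def compose_def fun_eq_iff PiE_def Pi_def extensional_def)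
qed

end

theory Submission
  imports Defs
begin

text \<open>An epimorphism sends constant maps, which are the left zeros, to constant maps, and so it
  induces a surjection \<open>\<psi>\<close> of the domains with \<open>\<psi> \<circ> f = \<phi> f \<circ> \<psi>\<close> for all \<open>f\<close>. If \<open>\<psi>\<close> identified
  two distinct points, then composing with affine maps, of small image since the first domain is
  bounded, would make \<open>\<psi>\<close> locally constant, hence constant. So \<open>\<psi>\<close> is injective, and
  \<open>\<phi> f\<close> determines \<open>f\<close>.\<close>

lemma norm_vector_scalar_mult:
  fixes w :: "'a::real_normed_div_algebra ^ 'n"
  shows "norm (c *s w) = norm c * norm w"
  by (simp add: norm_vec_def norm_mult L2_set_right_distrib)

lemma holomorphic_map_on_const: "holomorphic_map_on (\<lambda>z. c) S"
  unfolding holomorphic_map_on_def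
  by (intro ballI exI[of _ "\<lambda>_. 0"]) (simp add: vec_eq_iff)

text \<open>Finite dimension makes \<open>L\<close> bounded, so \<open>L\<close> is itself the
  derivative at every point; its complex homogeneity is then exactly what holomorphy adds to real
  differentiability.\<close>

lemma holomorphic_map_on_affine:
  fixes p :: "complex ^ 'm" and a :: "complex ^ 'n"
  assumes "linear L" and "\<And>c v. L (c *s v) = c *s L v"
  shows "holomorphic_map_on (\<lambda>z. p + L (z - a)) S"
  unfolding holomorphic_map_on_def
proof
  fix z
  have "bounded_linear L"
    using assms(1) by (simp add: linear_conv_bounded_linear)
  then have "((\<lambda>z. L (z - a)) has_derivative (\<lambda>v. L (v - 0))) (at z within S)"
    by (rule bounded_linear.has_derivative)
      (intro has_derivative_diff has_derivative_ident has_derivative_const)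
  then have "((\<lambda>z. p + L (z - a)) has_derivative L) (at z within S)"
    using has_derivative_add[OF has_derivative_const] by fastforce
  with assms(2)
  show "\<exists>D. ((\<lambda>z. p + L (z - a)) has_derivative D) (at z within S) \<and> (\<forall>c v. D (c *s v) = c *s D v)"
    by blast
qed

lemma restrict_mem_holo_endos:
  assumes "f ` S \<subseteq> S" and "holomorphic_map_on f S"
  shows "restrict f S \<in> carrier (holo_endos S)"
  using assms holomorphic_map_on_cong[of S f "restrict f S"]
  by (auto simp: holo_endos_def)

lemma const_mem_holo_endos: "c \<in> S \<Longrightarrow> (\<lambda>z\<in>S. c) \<in> carrier (holo_endos S)"
  by (intro restrict_mem_holo_endos holomorphic_map_on_const) auto

lemma holo_endos_mem: "f \<in> carrier (holo_endos S) \<Longrightarrow> z \<in> S \<Longrightarrow> f z \<in> S"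
  by (auto simp: holo_endos_def)

lemma mult_holo_endos [simp]: "mult (holo_endos S) = compose S"
  by (simp add: holo_endos_def)

lemma compose_const:
  assumes "f \<in> carrier (holo_endos S)" and "a \<in> S"
  shows "compose S f (\<lambda>z\<in>S. a) = (\<lambda>z\<in>S. f a)" "compose S (\<lambda>z\<in>S. a) f = (\<lambda>z\<in>S. a)"
  using assms by (auto simp: compose_def fun_eq_iff holo_endos_mem)

text \<open>Testing the left zero property on the constant map \<open>h\<close> at \<open>b\<close>
  suffices: then \<open>g\<close> after \<open>h\<close> takes only the value
  \<open>g b\<close>.\<close>

lemma holo_endos_left_zeroE:
  assumes "g \<in> carrier (holo_endos S)" and "b \<in> S"
    and "\<And>h. h \<in> carrier (holo_endos S) \<Longrightarrow> compose S g h = g"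
  shows "g = (\<lambda>z\<in>S. g b)"
  using assms(3)[OF const_mem_holo_endos[OF assms(2)]] compose_const(1)[OF assms(1,2)] by simp

text \<open>Choose a coordinate \<open>i\<close> that separates \<open>a\<close> from
  \<open>b\<close>. The affine map \<open>p + ((z $ i - a $ i) / (b $ i - a $ i)) *s (q - p)\<close>
  takes \<open>a\<close> to \<open>p\<close> and \<open>b\<close> to \<open>q\<close>. Its values
  stay on the complex line through \<open>p\<close> in direction \<open>q - p\<close>, and since
  \<open>S\<close> is bounded they stay close to \<open>p\<close> when \<open>q\<close>
  does.\<close>

lemma holo_endos_two_points:
  fixes S :: "(complex ^ 'n) set"
  assumes "open S" and "bounded S" and "p \<in> S" and "a \<in> S" and "b \<in> S" and "a \<noteq> b"
  shows "\<exists>e>0. \<forall>q\<in>ball p e. \<exists>f\<in>carrier (holo_endos S). f a = p \<and> f b = q"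
proof -
  obtain i where i: "a $ i \<noteq> b $ i"
    using \<open>a \<noteq> b\<close> by (auto simp: vec_eq_iff)
  define k where "k = b $ i - a $ i"
  have k: "k \<noteq> 0" using i by (simp add: k_def)
  obtain r where r: "r > 0" "ball p r \<subseteq> S"
    using assms(1,3) by (auto simp: open_contains_ball)
  obtain M where M: "M > 0" "\<And>z. z \<in> S \<Longrightarrow> norm z \<le> M"
    using assms(2) by (auto simp: bounded_pos)
  \<comment> \<open>On \<open>S\<close> the coefficient of \<open>q - p\<close> has modulus at most
    \<open>2 * M / cmod k\<close>, so this radius keeps every value within distance \<open>r\<close>
    of \<open>p\<close>.\<close>
  define e where "e = r * cmod k / (2 * M)"
  have "e > 0" using r M k by (simp add: e_def)
  moreover have "\<exists>f\<in>carrier (holo_endos S). f a = p \<and> f b = q" if q: "q \<in> ball p e" for q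
  proof -
    define L where "L = (\<lambda>v :: complex ^ 'n. (v $ i / k) *s (q - p))"
    have "linear L"
      by (rule linearI)
        (simp_all add: L_def vec_eq_iff add_divide_distrib algebra_simps
          scaleR_conv_of_real[where 'a = complex])
    moreover have "L (c *s v) = c *s L v" for c v
      by (simp add: L_def vec_eq_iff)
    ultimately have hol: "holomorphic_map_on (\<lambda>z. p + L (z - a)) S"
      by (rule holomorphic_map_on_affine)
    have "p + L (z - a) \<in> S" if z: "z \<in> S" for z
    proof -
      have "cmod ((z - a) $ i) \<le> norm (z - a)"
        by (rule Finite_Cartesian_Product.norm_nth_le)
      also have "\<dots> \<le> 2 * M"
        using norm_triangle_ineq4[of z a] M(2)[OF z] M(2)[OF \<open>a \<in> S\<close>] by simp
      finally have "norm (L (z - a)) \<le> 2 * M / cmod k * norm (q - p)"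
        unfolding L_def norm_vector_scalar_mult norm_divide
        by (intro mult_right_mono divide_right_mono) auto
      also have "\<dots> < 2 * M / cmod k * e"
        using q M k by (intro mult_strict_left_mono) (auto simp: dist_norm norm_minus_commute)
      also have "\<dots> = r" using M k by (simp add: e_def)
      finally have "p + L (z - a) \<in> ball p r" by (simp add: dist_norm)
      with r show ?thesis by blast
    qed
    then have "restrict (\<lambda>z. p + L (z - a)) S \<in> carrier (holo_endos S)"
      by (intro restrict_mem_holo_endos hol) auto
    moreover have "L (b - a) = q - p" "L (a - a) = 0"
      using k by (simp_all add: L_def k_def)
    ultimately show ?thesis
      using \<open>a \<in> S\<close> \<open>b \<in> S\<close> by (intro bexI[of _ "restrict (\<lambda>z. p + L (z - a)) S"]) auto
  qed
  ultimately show ?thesis by blast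
qed

text \<open>If \<psi> identifies \<open>a\<close> and \<open>b\<close>, it identifies
  \<open>f a\<close> and \<open>f b\<close> for every endomorphism \<open>f\<close>, because
  \<open>g\<close> sees only the common value. With \<open>f a = p\<close> fixed, \<open>f b\<close>
  can be any point near \<open>p\<close>, so \<psi> is constant near \<open>p\<close>.\<close>

lemma semiconjugacy_inj_on:
  fixes S :: "(complex ^ 'n) set" and \<psi> :: "complex ^ 'n \<Rightarrow> 'b"
  assumes "is_domain S" and "bounded S" and "\<not> \<psi> constant_on S"
    and semiconj: "\<And>f. f \<in> carrier (holo_endos S) \<Longrightarrow> \<exists>g. \<forall>z\<in>S. \<psi> (f z) = g (\<psi> z)"
  shows "inj_on \<psi> S"
proof (rule inj_onI, rule ccontr)
  fix a b assume ab: "a \<in> S" "b \<in> S" "\<psi> a = \<psi> b" "a \<noteq> b"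
  have S: "open S" "connected S" using assms(1) by (auto simp: is_domain_def)
  have "\<psi> constant_on S"
  proof (rule locally_constant_imp_constant[OF S(2)])
    fix p assume p: "p \<in> S"
    obtain e where e: "e > 0"
      "\<forall>q\<in>ball p e. \<exists>f\<in>carrier (holo_endos S). f a = p \<and> f b = q"
      using holo_endos_two_points[OF S(1) assms(2) p ab(1,2,4)] by blast
    have "\<psi> q = \<psi> p" if q: "q \<in> ball p e" for q
    proof -
      obtain f where f: "f \<in> carrier (holo_endos S)" "f a = p" "f b = q"
        using e(2) q by blast
      obtain g where "\<forall>z\<in>S. \<psi> (f z) = g (\<psi> z)"
        using semiconj[OF f(1)] by blast
      with f ab(1-3) show ?thesis by metis
    qed
    moreover have "openin (top_of_set S) (S \<inter> ball p e)"
      by (rule openin_open_Int) simp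
    ultimately show "\<exists>T. openin (top_of_set S) T \<and> p \<in> T \<and> (\<forall>x\<in>T. \<psi> x = \<psi> p)"
      using p centre_in_ball[of p e] e(1) by blast
  qed
  with assms(3) show False by contradiction
qed

theorem theorem4p10p1:
  fixes \<Omega>\<^sub>1 :: "(complex ^ 'n) set" and \<Omega>\<^sub>2 :: "(complex ^ 'm) set"
    and \<phi> :: "(complex ^ 'n \<Rightarrow> complex ^ 'n) \<Rightarrow> (complex ^ 'm \<Rightarrow> complex ^ 'm)"
  assumes "is_domain \<Omega>\<^sub>1" and "bounded \<Omega>\<^sub>1"
    and "is_domain \<Omega>\<^sub>2" and "bounded \<Omega>\<^sub>2"
    and "\<phi> \<in> epi (holo_endos \<Omega>\<^sub>1) (holo_endos \<Omega>\<^sub>2)"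
  shows "\<phi> \<in> iso (holo_endos \<Omega>\<^sub>1) (holo_endos \<Omega>\<^sub>2)"
proof -
  let ?E1 = "carrier (holo_endos \<Omega>\<^sub>1)" and ?E2 = "carrier (holo_endos \<Omega>\<^sub>2)"
  have hom: "\<phi> \<in> hom (holo_endos \<Omega>\<^sub>1) (holo_endos \<Omega>\<^sub>2)" and surj: "\<phi> ` ?E1 = ?E2"
    using assms(5) by (auto simp: epi_def)
  have comp: "\<phi> (compose \<Omega>\<^sub>1 f g) = compose \<Omega>\<^sub>2 (\<phi> f) (\<phi> g)" if "f \<in> ?E1" "g \<in> ?E1" for f g
    using hom_mult[OF hom that] by simp
  have closed: "\<phi> f \<in> ?E2" if "f \<in> ?E1" for f
    using surj that by blast
  obtain a0 where a0: "a0 \<in> \<Omega>\<^sub>1" using assms(1) by (auto simp: is_domain_def)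
  obtain b0 where b0: "b0 \<in> \<Omega>\<^sub>2" using assms(3) by (auto simp: is_domain_def)
  \<comment> \<open>Evaluation at \<open>b0\<close> is an arbitrary choice: for \<open>a\<close> in
    the first domain, the image of the constant map at \<open>a\<close> turns out to be
    constant.\<close>
  define \<psi> where "\<psi> a = \<phi> (\<lambda>z\<in>\<Omega>\<^sub>1. a) b0" for a
  have \<psi>_mem: "\<psi> a \<in> \<Omega>\<^sub>2" if "a \<in> \<Omega>\<^sub>1" for a
    unfolding \<psi>_def by (rule holo_endos_mem[OF closed[OF const_mem_holo_endos[OF that]] b0])
  have \<phi>_const: "\<phi> (\<lambda>z\<in>\<Omega>\<^sub>1. a) = (\<lambda>z\<in>\<Omega>\<^sub>2. \<psi> a)" if a: "a \<in> \<Omega>\<^sub>1" for a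
    unfolding \<psi>_def
  proof (rule holo_endos_left_zeroE[OF closed[OF const_mem_holo_endos[OF a]] b0])
    \<comment> \<open>Surjectivity enters here: the image of a left zero absorbs only maps of the
      form \<open>\<phi> f\<close>, and these are all of \<open>?E2\<close>.\<close>
    fix h assume "h \<in> ?E2"
    then obtain f where "f \<in> ?E1" "h = \<phi> f" using surj by blast
    then show "compose \<Omega>\<^sub>2 (\<phi> (\<lambda>z\<in>\<Omega>\<^sub>1. a)) h = \<phi> (\<lambda>z\<in>\<Omega>\<^sub>1. a)"
      using comp[OF const_mem_holo_endos[OF a]] compose_const(2)[OF _ a] by metis
  qed
  have semiconj: "\<psi> (f a) = \<phi> f (\<psi> a)" if f: "f \<in> ?E1" and a: "a \<in> \<Omega>\<^sub>1" for f a
  proof -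
    \<comment> \<open>Apply \<phi> to the identity saying that \<open>f\<close> after the constant
      map at \<open>a\<close> is the constant map at \<open>f a\<close>, then compare the two
      constant values.\<close>
    have "(\<lambda>z\<in>\<Omega>\<^sub>2. \<psi> (f a)) = \<phi> (compose \<Omega>\<^sub>1 f (\<lambda>z\<in>\<Omega>\<^sub>1. a))"
      by (simp only: compose_const(1)[OF f a] \<phi>_const[OF holo_endos_mem[OF f a]])
    also have "\<dots> = (\<lambda>z\<in>\<Omega>\<^sub>2. \<phi> f (\<psi> a))"
      by (simp only: comp[OF f const_mem_holo_endos[OF a]] \<phi>_const[OF a]
          compose_const(1)[OF closed[OF f] \<psi>_mem[OF a]])
    finally show ?thesis using b0 by (metis restrict_apply')
  qed
  have \<psi>_surj: "\<Omega>\<^sub>2 \<subseteq> \<psi> ` \<Omega>\<^sub>1"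
  proof
    fix b assume b: "b \<in> \<Omega>\<^sub>2"
    \<comment> \<open>A preimage \<open>f\<close> of the constant map at \<open>b\<close> is not
      known to be constant, but the semiconjugacy at the single point \<open>a0\<close> already
      yields \<open>\<psi> (f a0) = b\<close>.\<close>
    then have "(\<lambda>z\<in>\<Omega>\<^sub>2. b) \<in> \<phi> ` ?E1"
      by (simp only: surj const_mem_holo_endos)
    then obtain f where f: "f \<in> ?E1" "\<phi> f = (\<lambda>z\<in>\<Omega>\<^sub>2. b)"
      by force
    then have "\<psi> (f a0) = b" using semiconj[OF f(1) a0] \<psi>_mem[OF a0] by simp
    with holo_endos_mem[OF f(1) a0] show "b \<in> \<psi> ` \<Omega>\<^sub>1" by blast
  qed
  have "\<not> \<psi> constant_on \<Omega>\<^sub>1"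
  proof
    assume "\<psi> constant_on \<Omega>\<^sub>1"
    then obtain y where "\<forall>x\<in>\<Omega>\<^sub>1. \<psi> x = y" by (auto simp: constant_on_def)
    then have "x = y" if "x \<in> \<Omega>\<^sub>2" for x using \<psi>_surj that by blast
    \<comment> \<open>A constant \<psi> would shrink the second domain to one point, which is not
      open.\<close>
    with b0 have "\<Omega>\<^sub>2 = {b0}" by blast
    then show False using assms(3) not_open_singleton[of b0] by (simp add: is_domain_def)
  qed
  then have inj: "inj_on \<psi> \<Omega>\<^sub>1"
    by (rule semiconjugacy_inj_on[OF assms(1,2)]) (use semiconj in blast)
  have "inj_on \<phi> ?E1"
  proof (rule inj_onI)
    fix f g assume fg: "f \<in> ?E1" "g \<in> ?E1" "\<phi> f = \<phi> g"
    \<comment> \<open>Here \<open>\<psi> (f z) = \<phi> f (\<psi> z) = \<phi> g (\<psi> z) = \<psi>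
      (g z)\<close>, and injectivity cancels \<psi>. Agreement on the domain then gives equality,
      since both maps are \<open>undefined\<close> outside it.\<close>
    have "f z = g z" if "z \<in> \<Omega>\<^sub>1" for z
      using inj_onD[OF inj, of "f z" "g z"] fg that by (simp add: semiconj holo_endos_mem)
    with fg(1,2) show "f = g"
      by (auto simp: holo_endos_def intro: PiE_ext)
  qed
  with hom surj show ?thesis by (simp add: iso_def bij_betw_def)
qed

end
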